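(* Let $m$ be an odd integer with $m\equiv 3\pmod 4$, and let $n\ge 1$ be an even integer. Then the digraph $\mathit{SB}(m,n)$ has no Hamiltonian cycle.
   Context: For integers $m,n\ge 1$, let $\Sigma_m=\{0,1,\dots,m-1\}$. The shift-and-save-or-bump digraph $\mathit{SB}(m,n)$ has vertex set $\Sigma_m^n$ and, from each vertex $x_1x_2\dots x_n$, exactly two arcs: the "save" arc $x_1x_2\dots x_n\to x_2\dots x_n x_1$ and the "bump" arc $x_1x_2\dots x_n\to x_2\dots x_n x_1^+$, where $x_1^+=(x_1+1)\bmod m$. (When $x_1=\dots=x_n$ the save arc is a self-loop.) A Hamiltonian cycle is a directed cycle visiting every vertex exactly once. *)

theory Defs
  imports "Graph_Theory.Arc_Walk" "HOL-Number_Theory.Cong"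
begin

datatype move = Save | Bump

fun move_digit :: "nat \<Rightarrow> move \<Rightarrow> nat \<Rightarrow> nat" where
  "move_digit m Save a = a"
| "move_digit m Bump a = (a + 1) mod m"

text \<open>A word over the digits below \<open>m\<close> is a list of natural numbers. An arc is its source
  vertex together with its kind, so every vertex has exactly two outgoing arcs, which are parallel
  if \<open>m = 1\<close>. The definition is intended for \<open>m \<ge> 1\<close> and \<open>n \<ge> 1\<close> only.\<close>

definition SB :: "nat \<Rightarrow> nat \<Rightarrow> (nat list, nat list \<times> move) pre_digraph" where
  "SB m n =
     \<lparr> verts = {x. length x = n \<and> set x \<subseteq> {0..<m}},
       arcs = {x. length x = n \<and> set x \<subseteq> {0..<m}} \<times> UNIV,
       tail = fst,
       head = (\<lambda>(x, k). tl x @ [move_digit m k (hd x)]) \<rparr>"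

text \<open>The library's \<^const>\<open>pre_digraph.cycle\<close> is a nonempty closed arc walk (a single loop is
  allowed) that does not repeat a vertex apart from its endpoints coinciding. The arcs of such a
  walk therefore have distinct tails, so the second conjunct says that every vertex is visited
  exactly once.\<close>

definition hamiltonian_cycle :: "('a, 'b) pre_digraph \<Rightarrow> 'b list \<Rightarrow> bool" where
  "hamiltonian_cycle G p \<longleftrightarrow> pre_digraph.cycle G p \<and> tail G ` set p = verts G"

lemma wf_digraph_SB:
  assumes "m \<ge> 1" and "n \<ge> 1"
  shows "wf_digraph (SB m n)"
proof
  fix e assume e: "e \<in> arcs (SB m n)"
  obtain x k where xk: "e = (x, k)" by (cases e)
  show "tail (SB m n) e \<in> verts (SB m n)"
    using e by (auto simp: SB_def)
  have x: "length x = n" "set x \<subseteq> {0..<m}"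
    using e xk by (auto simp: SB_def)
  obtain a y where "x = a # y"
    using x(1) assms(2) by (cases x) auto
  then show "head (SB m n) e \<in> verts (SB m n)"
    using x assms(1) xk by (cases k) (auto simp: SB_def)
qed

end

theory Submission
  imports Defs "HOL-Combinatorics.Cycles"
begin

text \<open>A Hamiltonian cycle is a single cycle through all \<open>m\<^sup>n\<close> words, an odd number, so as
  a permutation it is even. On the other hand it is a rotation of the coordinates composed with a
  permutation that fixes or increments the first digit; injectivity forces the latter to have order
  dividing \<open>m\<close>, so it is even as well. But the rotation of \<open>n\<close> coordinates is a product of
  \<open>n - 1\<close> exchanges of adjacent coordinates, and each exchange is a product of
  \<open>m\<^bsup>n-2\<^esup> (m choose 2)\<close> disjoint transpositions, an odd number if \<open>m\<close> is congruent to 3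
  modulo 4. So for even \<open>n\<close> the rotation is odd, a contradiction.\<close>

section \<open>Signs of permutations\<close>

lemma permutation_funpow: "permutation p \<Longrightarrow> permutation (p ^^ k)"
  by (induction k) (auto intro: permutation_compose)

lemma sign_funpow: "permutation p \<Longrightarrow> sign (p ^^ k) = sign p ^ k"
  by (induction k) (auto simp: sign_compose permutation_funpow)

text \<open>A sign is 1 or -1, and no odd power of -1 equals 1.\<close>

lemma sign_eq_1_if_funpow_odd:
  assumes "permutation p" and "p ^^ k = id" and "odd k"
  shows "sign p = 1"
proof -
  have "sign p ^ k = 1"
    using sign_funpow[OF assms(1), of k] assms(2) by simp
  then show ?thesis
    using \<open>odd k\<close> by (cases p rule: sign_cases) auto
qed

text \<open>The set \<open>A\<close> contains exactly one point of every 2-cycle of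
  \<open>p\<close>, so \<open>p\<close> is a product of \<open>card A\<close> disjoint
  transpositions. The induction splits them off one at a time.\<close>

lemma sign_involution:
  assumes "finite A" and "\<And>x. p (p x) = x" and "A \<inter> p ` A = {}" and "{x. p x \<noteq> x} \<subseteq> A \<union> p ` A"
  shows "sign p = (- 1) ^ card A"
  using assms
proof (induction A arbitrary: p rule: finite_induct)
  case empty
  then have "p = id" by auto
  then show ?case by simp
next
  case (insert a A)
  \<comment> \<open>\<open>q\<close> fixes \<open>a\<close> and \<open>p a\<close> and agrees with
    \<open>p\<close> elsewhere, so it is again an involution, now with representatives
    \<open>A\<close> alone.\<close>
  define q where "q = transpose a (p a) \<circ> p"
  have a: "p a \<noteq> a" using insert.prems(2) by auto
  have qa: "q a = a" "q (p a) = p a" by (simp_all add: q_def insert.prems(1))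
  have q: "q x = p x" if "x \<noteq> a" "x \<noteq> p a" for x
    using that insert.prems(1)[of x] insert.prems(1)[of a]
    by (auto simp: q_def transpose_def)
  have qA: "q x = p x" if "x \<in> A" for x
    using that insert.hyps(2) insert.prems(2) by (intro q) auto
  have qq: "q (q x) = x" for x
  proof (cases "x = a \<or> x = p a")
    case False
    then have "p x \<noteq> a" "p x \<noteq> p a" using insert.prems(1) by metis+
    then show ?thesis using False by (simp add: q insert.prems(1))
  qed (use qa in auto)
  have im: "q ` A = p ` A" using qA by auto
  have "{x. q x \<noteq> x} \<subseteq> A \<union> q ` A"
  proof safe
    fix x assume "q x \<noteq> x" "x \<notin> q ` A"
    then have "x \<noteq> a" "x \<noteq> p a" using qa by auto
    with \<open>q x \<noteq> x\<close> \<open>x \<notin> q ` A\<close> show "x \<in> A"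
      using q insert.prems(3) im by fastforce
  qed
  then have fin: "finite {x. q x \<noteq> x}"
    using insert.hyps(1) finite_subset by blast
  have "bij q" by (rule involuntory_imp_bij) (rule qq)
  then have "permutation q" using fin by (simp add: permutation)
  have "sign q = (- 1) ^ card A"
    using insert.IH[OF qq] insert.prems(2) \<open>{x. q x \<noteq> x} \<subseteq> A \<union> q ` A\<close> im by auto
  moreover have "p = transpose a (p a) \<circ> q"
    by (auto simp: q_def fun_eq_iff)
  then have "sign p = sign (transpose a (p a) \<circ> q)" by simp
  then have "sign p = - sign q"
    using a by (simp add: sign_compose permutation_swap_id \<open>permutation q\<close> sign_swap_id)
  ultimately show ?case using insert.hyps by simp
qed

text \<open>If \<open>f x \<noteq> x\<close>, injectivity keeps the orbit of \<open>x\<close> away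
  from fixed points: \<open>f (f y) = f y\<close> would give \<open>f y = y\<close>. Hence
  \<open>f\<close> follows \<open>g\<close> along the whole orbit and returns after \<open>k\<close>
  steps.\<close>

lemma funpow_id_if_fix_or_agree:
  assumes "inj f" and "\<And>x. f x = x \<or> f x = g x" and "g ^^ k = id"
  shows "f ^^ k = id"
proof
  fix x
  show "(f ^^ k) x = id x"
  proof (cases "f x = x")
    case True
    then have "(f ^^ i) x = x" for i by (induction i) auto
    then show ?thesis by simp
  next
    case False
    have "(f ^^ i) x = (g ^^ i) x \<and> f ((f ^^ i) x) \<noteq> (f ^^ i) x" for i
    proof (induction i)
      case (Suc i)
      let ?y = "(f ^^ i) x"
      have "f ?y = g ?y" using assms(2)[of ?y] Suc by auto
      moreover have "f (f ?y) \<noteq> f ?y" using Suc inj_eq[OF assms(1)] by blast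
      ultimately show ?case using Suc by (metis comp_apply funpow.simps(2))
    qed (use False in simp)
    then show ?thesis using assms(3) by simp
  qed
qed

section \<open>Rotations of words\<close>

definition words :: "nat \<Rightarrow> nat \<Rightarrow> nat list set" where
  "words m n = {x. length x = n \<and> set x \<subseteq> {0..<m}}"

lemma finite_words: "finite (words m n)" and card_words: "card (words m n) = m ^ n"
proof -
  have "words m n = {x. set x \<subseteq> {0..<m} \<and> length x = n}"
    by (auto simp: words_def)
  then show "finite (words m n)" and "card (words m n) = m ^ n"
    by (simp_all add: finite_lists_length_eq card_lists_length_eq)
qed

definition swap_adj :: "nat \<Rightarrow> 'a list \<Rightarrow> 'a list" where
  "swap_adj i x = x[i := x ! Suc i, Suc i := x ! i]"

lemma swap_adj_append [simp]: "length u = i \<Longrightarrow> swap_adj i (u @ a # b # v) = u @ b # a # v"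
  by (auto simp: swap_adj_def list_update_append nth_append)

lemma words_split_adj:
  assumes "x \<in> words m n" and "Suc i < n"
  obtains u a b v where "x = u @ a # b # v" "u \<in> words m i" "v \<in> words m (n - 2 - i)" "a < m" "b < m"
proof -
  have x: "x = take i x @ x ! i # x ! Suc i # drop (Suc (Suc i)) x"
    using assms by (simp add: words_def Cons_nth_drop_Suc Suc_lessD)
  have "set (take i x) \<subseteq> set x" "set (drop (Suc (Suc i)) x) \<subseteq> set x"
    by (rule set_take_subset set_drop_subset)+
  moreover have "x ! i \<in> set x" "x ! Suc i \<in> set x"
    using assms by (simp_all add: words_def)
  then have "x ! i < m" "x ! Suc i < m"
    using assms(1) by (auto simp: words_def)
  ultimately have "take i x \<in> words m i" "drop (Suc (Suc i)) x \<in> words m (n - 2 - i)"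
    "x ! i < m" "x ! Suc i < m"
    using assms by (auto simp: words_def)
  then show ?thesis by (rule that[OF x])
qed

lemma append_adj_words:
  assumes "u \<in> words m i" and "v \<in> words m (n - 2 - i)" and "a < m" and "b < m" and "Suc i < n"
  shows "u @ a # b # v \<in> words m n"
  using assms by (auto simp: words_def)

text \<open>Such a word amounts to a prefix, a pair \<open>a < b\<close> and a suffix. The count is
  thus a power of the odd number \<open>m\<close> times \<open>m (m - 1) / 2\<close>, and the latter
  is odd because \<open>m - 1\<close> is 2 modulo 4.\<close>

lemma odd_card_adj_less:
  assumes "m mod 4 = 3" and "Suc i < n"
  shows "odd (card {x \<in> words m n. x ! i < x ! Suc i})"
proof -
  \<comment> \<open>The larger digit \<open>b\<close> comes first in the pair: it leaves
    \<open>b\<close> choices for the smaller one, so the pairs are counted by the sum of all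
    \<open>b < m\<close>.\<close>
  let ?S = "words m i \<times> (SIGMA b:{..<m}. {..<b}) \<times> words m (n - 2 - i)"
  let ?g = "\<lambda>(u, (b, a), v). u @ a # b # v"
  have "{x \<in> words m n. x ! i < x ! Suc i} = ?g ` ?S"
  proof (intro equalityI subsetI)
    fix x assume x: "x \<in> {x \<in> words m n. x ! i < x ! Suc i}"
    then obtain u a b v where *: "x = u @ a # b # v" "u \<in> words m i" "v \<in> words m (n - 2 - i)" "a < m" "b < m"
      using words_split_adj[OF _ assms(2)] by blast
    moreover have "length u = i" using * by (simp add: words_def)
    then have "a < b" using x * by (auto simp: nth_append)
    ultimately have "(u, (b, a), v) \<in> ?S" "x = ?g (u, (b, a), v)" by auto
    then show "x \<in> ?g ` ?S" by blast
  next
    fix x assume "x \<in> ?g ` ?S"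
    then obtain u a b v where *: "x = u @ a # b # v" "u \<in> words m i" "v \<in> words m (n - 2 - i)" "a < b" "b < m"
      by auto
    have "length u = i" using * by (simp add: words_def)
    then show "x \<in> {x \<in> words m n. x ! i < x ! Suc i}"
      using append_adj_words[OF *(2,3) _ *(5) assms(2), of a] * by (auto simp: nth_append)
  qed
  moreover have "inj_on ?g ?S"
    by (auto simp: inj_on_def words_def)
  ultimately have "card {x \<in> words m n. x ! i < x ! Suc i} = card ?S"
    by (simp add: card_image)
  also have "\<dots> = m ^ i * (\<Sum>b<m. b) * m ^ (n - 2 - i)"
    by (simp add: card_cartesian_product card_words)
  finally have card: "card {x \<in> words m n. x ! i < x ! Suc i} = m ^ i * (\<Sum>b<m. b) * m ^ (n - 2 - i)" .
  define q where "q = m div 4"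
  have m: "m = 4 * q + 3" using assms(1) by (simp add: q_def) presburger
  have "(\<Sum>b<m. b) = (\<Sum>b=0..4 * q + 2. b)"
    unfolding m by (rule sum.cong) auto
  also have "\<dots> = (4 * q + 2) * Suc (4 * q + 2) div 2"
    by (rule gauss_sum_nat)
  also have "(4 * q + 2) * Suc (4 * q + 2) = 2 * ((2 * q + 1) * (4 * q + 3))"
    by (simp add: algebra_simps)
  also have "\<dots> div 2 = (2 * q + 1) * (4 * q + 3)"
    by (rule nonzero_mult_div_cancel_left) simp
  finally have "odd (\<Sum>b<m. b)" by simp
  moreover have "odd m" unfolding m by simp
  ultimately show ?thesis unfolding card by simp
qed

text \<open>The exchange moves just the words whose digits at \<open>i\<close> and
  \<open>Suc i\<close> differ. Each of its 2-cycles has one word ascending there and one descending,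
  so the ascending words serve as representatives. Since \<open>sign\<close> concerns maps on the
  whole type, \<open>restrict_id\<close> makes the exchange the identity on all other lists.\<close>

lemma sign_swap_adj:
  assumes "m mod 4 = 3" and "Suc i < n"
  shows "restrict_id (swap_adj i) (words m n) permutes words m n"
    and "sign (restrict_id (swap_adj i) (words m n)) = - 1"
proof -
  let ?s = "restrict_id (swap_adj i) (words m n)"
  let ?A = "{x \<in> words m n. x ! i < x ! Suc i}"
  have swap: "swap_adj i x \<in> words m n" "swap_adj i (swap_adj i x) = x"
      "swap_adj i x ! i = x ! Suc i" "swap_adj i x ! Suc i = x ! i"
      "x ! i = x ! Suc i \<Longrightarrow> swap_adj i x = x"
    if x: "x \<in> words m n" for x
  proof -
    obtain u a b v where *: "x = u @ a # b # v" "u \<in> words m i" "v \<in> words m (n - 2 - i)" "a < m" "b < m"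
      using words_split_adj[OF x assms(2)] by blast
    then have len: "length u = i" by (simp add: words_def)
    have s: "swap_adj i x = u @ b # a # v" unfolding *(1) using len by simp
    show "swap_adj i x \<in> words m n"
      unfolding s using append_adj_words[OF *(2,3,5,4) assms(2)] .
    show "swap_adj i (swap_adj i x) = x" unfolding s *(1) using len by simp
    show "swap_adj i x ! i = x ! Suc i" "swap_adj i x ! Suc i = x ! i"
      "x ! i = x ! Suc i \<Longrightarrow> swap_adj i x = x"
      unfolding s *(1) using len by (auto simp: nth_append)
  qed
  have inv: "?s (?s x) = x" for x
    by (cases "x \<in> words m n") (simp_all add: swap(1,2))
  show "?s permutes words m n"
    by (intro permutes_restrict_id bij_betwI[where g = "swap_adj i"] funcsetI swap(1,2))
  have "sign ?s = (- 1) ^ card ?A"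
  proof (rule sign_involution)
    show "finite ?A" using finite_words by simp
    have "?s x \<notin> ?A" if "x \<in> ?A" for x
      using that swap(3,4)[of x] by simp
    then show "?A \<inter> ?s ` ?A = {}" by blast
    show "{x. ?s x \<noteq> x} \<subseteq> ?A \<union> ?s ` ?A"
    proof
      fix x assume "x \<in> {x. ?s x \<noteq> x}"
      then have x: "x \<in> words m n" "swap_adj i x \<noteq> x"
        by (cases "x \<in> words m n"; simp)+
      consider "x ! i < x ! Suc i" | "x ! Suc i < x ! i"
        using swap(5)[OF x(1)] x(2) by linarith
      then show "x \<in> ?A \<union> ?s ` ?A"
      proof cases
        case 2
        then have "?s x \<in> ?A" using swap(1,3,4)[OF x(1)] x(1) by simp
        then show ?thesis by (intro UnI2 image_eqI[of _ _ "?s x"]) (simp only: inv)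
      qed (use x(1) in blast)
    qed
  qed (rule inv)
  then show "sign ?s = - 1"
    using odd_card_adj_less[OF assms] by simp
qed

text \<open>Rotating a prefix carries its first digit to its end. Lengthening the prefix by one
  digit costs one more adjacent exchange, hence one more factor -1.\<close>

lemma sign_rotate1_take:
  assumes "m mod 4 = 3" and "k < n"
  defines "r \<equiv> \<lambda>k. restrict_id (\<lambda>x. rotate1 (take k x) @ drop k x) (words m n)"
  shows "r (Suc k) permutes words m n \<and> sign (r (Suc k)) = (- 1) ^ k"
  using assms(2)
proof (induction k)
  case 0
  have "rotate1 (take (Suc 0) x) @ drop (Suc 0) x = x" for x :: "nat list"
    by (cases x) auto
  then have "r (Suc 0) = id" by (auto simp: r_def restrict_id_def)
  then show ?case by (metis permutes_id sign_id power_0)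
next
  case (Suc k)
  let ?s = "restrict_id (swap_adj k) (words m n)"
  have IH: "r (Suc k) permutes words m n" "sign (r (Suc k)) = (- 1) ^ k"
    using Suc by auto
  have s: "?s permutes words m n" "sign ?s = - 1"
    using sign_swap_adj[OF assms(1)] Suc.prems by auto
  \<comment> \<open>After \<open>r (Suc k)\<close> the original first digit stands at index
    \<open>k\<close>; the exchange moves it past the digit at index \<open>Suc k\<close>.\<close>
  have "r (Suc (Suc k)) x = ?s (r (Suc k) x)" for x
  proof (cases "x \<in> words m n")
    case True
    have "length x = n" using True by (simp add: words_def)
    then have x: "x = take (Suc k) x @ x ! Suc k # drop (Suc (Suc k)) x"
      using Suc.prems by (simp add: id_take_nth_drop)
    obtain a u where au: "take (Suc k) x = a # u"
      using \<open>length x = n\<close> Suc.prems by (cases x) auto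
    have "length u = k" using arg_cong[OF au, of length] \<open>length x = n\<close> Suc.prems by simp
    obtain b v where "x = take (Suc k) x @ b # v" using x by blast
    then have xx: "x = a # u @ b # v" unfolding au by simp
    have "r (Suc k) x \<in> words m n" using permutes_in_image[OF IH(1)] True by simp
    moreover have "r (Suc k) x = u @ a # b # v"
      using True \<open>length u = k\<close> by (simp add: r_def restrict_id_def xx)
    moreover have "r (Suc (Suc k)) x = u @ b # a # v"
      using True \<open>length u = k\<close> by (simp add: r_def restrict_id_def xx)
    ultimately show ?thesis using \<open>length u = k\<close> by simp
  qed (simp add: r_def restrict_id_def)
  then have r: "r (Suc (Suc k)) = ?s \<circ> r (Suc k)" by auto
  have "permutation ?s" "permutation (r (Suc k))"
    using permutes_imp_permutation[OF finite_words] s(1) IH(1) by blast+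
  then have "sign (r (Suc (Suc k))) = (- 1) ^ Suc k"
    unfolding r by (subst sign_compose) (simp_all add: IH s)
  moreover have "r (Suc (Suc k)) permutes words m n"
    unfolding r by (rule permutes_compose[OF IH(1) s(1)])
  ultimately show ?case by blast
qed

lemma sign_rotate1:
  assumes "m mod 4 = 3" and "n \<ge> 1"
  shows "restrict_id rotate1 (words m n) permutes words m n"
    and "sign (restrict_id rotate1 (words m n)) = (- 1) ^ (n - 1)"
proof -
  have "restrict_id (\<lambda>x. rotate1 (take n x) @ drop n x) (words m n) = restrict_id rotate1 (words m n)"
    by (auto simp: restrict_id_def words_def)
  then show "restrict_id rotate1 (words m n) permutes words m n"
    and "sign (restrict_id rotate1 (words m n)) = (- 1) ^ (n - 1)"
    using sign_rotate1_take[OF assms(1), of "n - 1" n] assms(2) by auto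
qed

section \<open>Hamiltonian cycles\<close>

text \<open>Each arc of a walk starts where the previous one ends. For a closed walk this makes the
  list of heads the list of tails rotated by one.\<close>

lemma cas_verts_shift:
  "pre_digraph.cas G u p v \<Longrightarrow> u # map (head G) p = map (tail G) p @ [v]"
  by (induction p arbitrary: u) (auto simp: pre_digraph.cas.simps)

text \<open>The map \<open>f\<close> is the cyclic permutation given by the list of tails. It
  advances that list by one place, which turns tails into heads.\<close>

lemma hamiltonian_cycle_successor:
  assumes "hamiltonian_cycle G p"
  obtains f where "f permutes verts G" and "f ^^ card (verts G) = id"
    and "\<And>v. v \<in> verts G \<Longrightarrow> \<exists>e \<in> arcs G. tail G e = v \<and> head G e = f v"
proof -
  let ?t = "map (tail G) p"
  obtain u where u: "pre_digraph.awalk G u p u" "distinct (tl (pre_digraph.awalk_verts G u p))" "p \<noteq> []"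
    using assms by (auto simp: hamiltonian_cycle_def pre_digraph.cycle_def)
  have cas: "pre_digraph.cas G u p u" and arcs: "set p \<subseteq> arcs G"
    using u(1) by (auto simp: pre_digraph.awalk_def)
  \<comment> \<open>The vertices of a nonempty walk after the first are the heads of its
    arcs.\<close>
  have "distinct (map (head G) p)"
    using u(2,3) pre_digraph.awalk_verts_conv'[OF cas] by simp
  moreover have heads: "map (head G) p = rotate1 ?t"
    using cas_verts_shift[OF cas] u(3) by (cases p) auto
  ultimately have dist: "distinct ?t" by simp
  have set: "set ?t = verts G" using assms by (simp add: hamiltonian_cycle_def)
  let ?f = "cycle_of_list ?t"
  have perm: "?f permutes verts G"
    using cycle_permutes[of ?t] set by simp
  \<comment> \<open>The list \<open>?t\<close> has length \<open>card (verts G)\<close>, and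
    rotating a list by its own length restores it.\<close>
  have "map (?f ^^ card (verts G)) ?t = ?t"
    using cyclic_rotation[OF dist, of "card (verts G)"] distinct_card[OF dist] set by simp
  then have "\<forall>v \<in> set ?t. (?f ^^ card (verts G)) v = v"
    using map_eq_conv[of "?f ^^ card (verts G)" ?t "\<lambda>v. v"] unfolding map_ident by blast
  then have "(?f ^^ card (verts G)) v = v" if "v \<in> verts G" for v
    using that unfolding set by blast
  moreover have "(?f ^^ k) v = v" if "v \<notin> verts G" for v k
    using permutes_not_in[OF perm that] by (induction k) auto
  ultimately have pow: "?f ^^ card (verts G) = id"
    unfolding fun_eq_iff id_apply by blast
  have "map ?f ?t = map (head G) p"
    using cyclic_rotation[OF dist, of 1] heads by simp
  then have "\<forall>e \<in> set p. ?f (tail G e) = head G e" by simp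
  then have "\<exists>e \<in> arcs G. tail G e = v \<and> head G e = ?f v" if v: "v \<in> verts G" for v
  proof -
    have "v \<in> tail G ` set p" using v set by simp
    then obtain e where "e \<in> set p" "tail G e = v" by blast
    then show ?thesis using arcs \<open>\<forall>e \<in> set p. ?f (tail G e) = head G e\<close> by auto
  qed
  then show ?thesis using that[OF perm pow] by blast
qed

text \<open>Written this way, a step first changes or keeps the leading digit and then rotates, so
  the two effects can be separated.\<close>

lemma SB_out_neighbour:
  assumes "e \<in> arcs (SB m n)" and "tail (SB m n) e = x"
  obtains c where "c = hd x \<or> c = (hd x + 1) mod m" and "head (SB m n) e = rotate1 (c # tl x)"
proof -
  obtain k where "e = (x, k)" using assms(2) by (cases e) (simp add: SB_def)
  then show ?thesis using that by (cases k) (auto simp: SB_def)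
qed

lemma funpow_increment_hd:
  assumes "m \<ge> 1" and "n \<ge> 1"
  defines "g \<equiv> restrict_id (\<lambda>x. (hd x + 1) mod m # tl x) (words m n)"
  shows "g ^^ m = id"
proof
  fix x
  show "(g ^^ m) x = id x"
  proof (cases "x \<in> words m n")
    case False
    then have "(g ^^ i) x = x" for i by (induction i) (auto simp: g_def)
    then show ?thesis by simp
  next
    case True
    then obtain a y where x: "x = a # y" using assms(2) by (cases x) (auto simp: words_def)
    have "(g ^^ i) x = (a + i) mod m # y" for i
    proof (induction i)
      case (Suc i)
      have "(a + i) mod m # y \<in> words m n" using True x assms(1) by (auto simp: words_def)
      then show ?case using Suc by (simp add: g_def mod_simps)
    qed (use True x in \<open>auto simp: words_def\<close>)
    then show ?thesis using True x by (simp add: words_def)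
  qed
qed

theorem theorem5p1:
  fixes m n :: nat
  assumes "odd m" and "[m = 3] (mod 4)" and "n \<ge> 1" and "even n"
  shows "\<not> (\<exists>p. hamiltonian_cycle (SB m n) p)"
proof
  assume "\<exists>p. hamiltonian_cycle (SB m n) p"
  then obtain f where f: "f permutes words m n" "f ^^ card (words m n) = id"
    and succ: "\<And>x. x \<in> words m n \<Longrightarrow> \<exists>e \<in> arcs (SB m n). tail (SB m n) e = x \<and> head (SB m n) e = f x"
    using hamiltonian_cycle_successor[of "SB m n"] by (auto simp: SB_def words_def)
  have m: "m mod 4 = 3" using assms(2) by (simp add: cong_def)
  have "m \<ge> 1" using \<open>odd m\<close> by (cases m) auto
  let ?R = "restrict_id rotate1 (words m n)"
  \<comment> \<open>Here the parity of \<open>n\<close> enters: \<open>n - 1\<close> is odd.\<close>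
  have R: "?R permutes words m n" "sign ?R = - 1"
    using sign_rotate1[OF m \<open>n \<ge> 1\<close>] \<open>n \<ge> 1\<close> \<open>even n\<close> by auto
  \<comment> \<open>Undoing the rotation leaves only the action of \<open>f\<close> on the first
    digit, which \<open>b\<close> keeps or increments.\<close>
  define b where "b = inv ?R \<circ> f"
  have b: "b permutes words m n"
    unfolding b_def by (intro permutes_compose f permutes_inv R)
  have perm: "permutation q" if "q permutes words m n" for q
    using that finite_words by (rule permutes_imp_permutation[rotated])
  let ?g = "restrict_id (\<lambda>x. (hd x + 1) mod m # tl x) (words m n)"
  \<comment> \<open>The comparison map \<open>?g\<close> increments the first digit of every word
    and so returns to the start after \<open>m\<close> steps.\<close>
  have "b ^^ m = id"
  proof (rule funpow_id_if_fix_or_agree)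
    show "inj b" using b by (rule permutes_inj)
    show "?g ^^ m = id" by (rule funpow_increment_hd[OF \<open>m \<ge> 1\<close> \<open>n \<ge> 1\<close>])
    fix x
    show "b x = x \<or> b x = ?g x"
    proof (cases "x \<in> words m n")
      case True
      then obtain a y where x: "x = a # y" using assms(3) by (cases x) (auto simp: words_def)
      obtain c where c: "c = a \<or> c = (a + 1) mod m" "f x = rotate1 (c # y)"
        using succ[OF True] SB_out_neighbour x by (metis list.sel(1,3))
      have "c # y \<in> words m n" using True x c(1) \<open>m \<ge> 1\<close> by (auto simp: words_def)
      then have "f x = ?R (c # y)" using c(2) by simp
      then have "b x = c # y" using permutes_inverses(2)[OF R(1)] by (simp add: b_def)
      then show ?thesis using c(1) x True by auto
    qed (use permutes_not_in[OF b] in simp)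
  qed
  then have "sign b = 1"
    using sign_eq_1_if_funpow_odd perm[OF b] \<open>odd m\<close> by blast
  \<comment> \<open>The order of \<open>f\<close> divides the number of words, \<open>m ^ n\<close>,
    which is odd.\<close>
  moreover have "sign f = 1"
    using sign_eq_1_if_funpow_odd[OF perm[OF f(1)] f(2)] \<open>odd m\<close> by (simp add: card_words)
  moreover have "f = ?R \<circ> b"
    using permutes_inverses(1)[OF R(1)] by (auto simp: b_def fun_eq_iff)
  then have "sign f = sign ?R * sign b"
    using sign_compose[OF perm[OF R(1)] perm[OF b]] by simp
  ultimately show False using R(2) by simp
qed

end
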